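(* Let $f:\Omega\to\mathbb{R}^{+}$ be smooth and block multiconvex, and let $\omega^{(k,i)}$ ($k\ge 1$, $1\le i\le d$) be the iterates produced by Algorithm APDOI from a starting point $\omega^{(0)}\in\Omega$. If there exists $\delta>0$ such that $$\sigma_{\min}\big(\nabla h_{(k,i)}(U^{(i)}_{k-1})\big)>\delta\qquad\text{for all }1\le i\le d\text{ and }k\ge 1,$$ then every accumulation point of the iterates $\omega^{(k,i)}$ is a stationary point of $f$.
   Context: Stiefel manifolds. For $1\le r\le n$, $\mathrm{St}(r,n,\mathbb{C})=\{X\in\mathbb{C}^{n\times r}:X^{H}X=I_r\}$, where $X^H$ is the conjugate transpose. $\mathbb{C}^{n\times r}$ is a real Euclidean space with inner product $\langle X,Y\rangle_{\Re}=\Re\,\mathrm{tr}(X^{H}Y)$; $\|\cdot\|$ is the Frobenius norm. For a function $h$, $\nabla h$ is the Euclidean gradient with respect to this inner product, and for $U\in\mathrm{St}(r,n,\mathbb{C})$ the Riemannian gradient is $\mathrm{grad}\,h(U)=\nabla h(U)-U\,\mathrm{sym}(U^{H}\nabla h(U))$, with $\mathrm{sym}(X)=\tfrac12(X+X^{H})$. Problem. $d>1$, $\Omega=\mathrm{St}(r_1,n_1,\mathbb{C})\times\cdots\times\mathrm{St}(r_d,n_d,\mathbb{C})$, and $f:\Omega\to\mathbb{R}^{+}=[0,\infty)$ is smooth. Fixing all blocks except the $i$-th, $h_{(i)}(U)=f(U^{(1)},\dots,U^{(i-1)},U,U^{(i+1)},\dots,U^{(d)})$; $h_{(i)}$ also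 denotes its natural (smooth) extension to $\mathbb{C}^{n_i\times r_i}$, and Euclidean gradients are those of this extension. $f$ is block multiconvex if $h_{(i)}$ is convex for every $i$ and every choice of the fixed blocks in the other Stiefel manifolds. The Riemannian gradient of $f$ at $\omega=(U^{(1)},\dots,U^{(d)})$ is $\mathrm{grad} f(\omega)=(\mathrm{grad}\,h_{(1)}(U^{(1)}),\dots,\mathrm{grad}\,h_{(d)}(U^{(d)}))$ with the other blocks in each $h_{(i)}$ fixed at those of $\omega$; $\omega$ is a stationary point if $\mathrm{grad} f(\omega)=0$. Polar decomposition. Every $X\in\mathbb{C}^{n\times r}$ ($r\le n$) can be written $X=UP$ with $U\in\mathrm{St}(r,n,\mathbb{C})$ (the orthogonal polar factor) and $P\in\mathbb{C}^{r\times r}$ Hermitian positive semidefinite; $U$ is unique if $X$ has full column rank. $\sigma_{\min}$ is the smallest singular value. Algorithm APDOI. Start from $\omega^{(0)}=(U^{(1)}_0,\dots,U^{(d)}_0)\in\Omega$ with $f(\omega^{(0)})>0$. For $k=1,2,\dots$ and, within each $k$, for $i=1,\dots,d$: let $h_{(k,i)}(U)=f(U^{(1)}_k,\dots,U^{(i-1)}_k,U,U^{(i+1)}_{k-1},\dots,U^{(d)}_{k-1})$ and let $U^{(i)}_k$ be the orthogonal polar factor of $\nabla h_{(k,i)}(U^{(i)}_{k-1})$. Set $\omega^{(k,i)}=(U^{(1)}_k,\dots,U^{(i)}_k,U^{(i+1)}_{k-1},\dots,U^{(d)}_{k-1})$; the iterates are ordered lexicographically in $(k,i)$. *)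

theory Defs
  imports "HOL-Analysis.Analysis"
begin

text \<open>
  The blocks of a tuple may have different sizes, so all of them live in one matrix type
  \<^typ>\<open>complex^'r^'n\<close>: an n-by-r block is a matrix with row set N and column set R, where
  card N = n and card R = r, that is zero outside N \<times> R. Sums, products and conjugate
  transposes of such matrices are those of the unpadded ones. As the finite index types are
  arbitrary, every choice of sizes occurs. A tuple is a vector of matrices indexed by 'd,
  whose linear order is the order of the blocks.
\<close>

definition ctranspose :: "complex^'r^'n \<Rightarrow> complex^'n^'r" where
  "ctranspose X = (\<chi> b a. cnj (X $ a $ b))"

text \<open>The library inner product on matrices is the one of the Frobenius norm.\<close>

lemma inner_eq_Re_trace:
  fixes X Y :: "complex^'r^'n"
  shows "inner X Y = Re (trace (ctranspose X ** Y))"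
proof -
  have "inner X Y = (\<Sum>a\<in>UNIV. \<Sum>b\<in>UNIV. Re (cnj (X $ a $ b) * Y $ a $ b))"
    by (simp add: inner_vec_def inner_complex_def)
  also have "\<dots> = (\<Sum>b\<in>UNIV. \<Sum>a\<in>UNIV. Re (cnj (X $ a $ b) * Y $ a $ b))"
    by (rule sum.swap)
  also have "\<dots> = Re (trace (ctranspose X ** Y))"
    by (simp add: trace_def ctranspose_def matrix_matrix_mult_def)
  finally show ?thesis .
qed

definition msym :: "complex^'r^'r \<Rightarrow> complex^'r^'r" where
  "msym X = (1/2) *\<^sub>R (X + ctranspose X)"

definition block_space :: "'n set \<Rightarrow> 'r set \<Rightarrow> (complex^'r^'n) set" where
  "block_space N R = {X. \<forall>a b. a \<notin> N \<or> b \<notin> R \<longrightarrow> X $ a $ b = 0}"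

definition crop :: "'n set \<Rightarrow> 'r set \<Rightarrow> complex^'r^'n \<Rightarrow> complex^'r^'n" where
  "crop N R X = (\<chi> a b. if a \<in> N \<and> b \<in> R then X $ a $ b else 0)"

definition id_on :: "'r set \<Rightarrow> complex^'r^'r" where
  "id_on R = (\<chi> a b. if a = b \<and> a \<in> R then 1 else 0)"

definition stiefel :: "'n set \<Rightarrow> 'r set \<Rightarrow> (complex^'r^'n) set" where
  "stiefel N R = {X \<in> block_space N R. ctranspose X ** X = id_on R}"

definition stiefel_prod ::
    "('d \<Rightarrow> 'n set) \<Rightarrow> ('d \<Rightarrow> 'r set) \<Rightarrow> (complex^'r^'n^'d) set" where
  "stiefel_prod N R = {\<omega>. \<forall>i. \<omega> $ i \<in> stiefel (N i) (R i)}"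

text \<open>C-infinity on an open set.\<close>

primrec ck_on :: "nat \<Rightarrow> ('a::real_normed_vector \<Rightarrow> 'b::real_normed_vector) \<Rightarrow> 'a set \<Rightarrow> bool" where
  "ck_on 0 f S \<longleftrightarrow> continuous_on S f"
| "ck_on (Suc k) f S \<longleftrightarrow> (\<forall>x\<in>S. f differentiable (at x)) \<and>
     (\<forall>v. ck_on k (\<lambda>x. frechet_derivative f (at x) v) S)"

declare ck_on.simps [simp del]

definition smooth_on :: "('a::real_normed_vector \<Rightarrow> 'b::real_normed_vector) \<Rightarrow> 'a set \<Rightarrow> bool" where
  "smooth_on f S \<longleftrightarrow> (\<forall>k. ck_on k f S)"

text \<open>
  The i-th restricted function of f with the other blocks fixed at those of \<omega>, as a function on
  all n-by-r matrices (the block i of \<omega> is irrelevant). Because of the cropping it does not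
  depend on the padding entries, so its gradient lies in the block space and is the gradient of
  the restriction to that space, and it is convex iff this restriction is.
\<close>

definition restr ::
    "('d \<Rightarrow> 'n set) \<Rightarrow> ('d \<Rightarrow> 'r set) \<Rightarrow> (complex^'r^'n^'d \<Rightarrow> real) \<Rightarrow> complex^'r^'n^'d \<Rightarrow> 'd
      \<Rightarrow> complex^'r^'n \<Rightarrow> real" where
  "restr N R f \<omega> i X = f (\<chi> j. if j = i then crop (N i) (R i) X else \<omega> $ j)"

text \<open>
  A function is smooth on the Stiefel product if it is the restriction of a smooth function on an
  open neighbourhood. The function f below stands at once for the given function, for such an
  extension, and for the extensions of its restricted functions to whole matrix spaces. Its
  values at all other points of the type play no role.
\<close>

definition smooth_objective ::
    "('d::finite \<Rightarrow> 'n::finite set) \<Rightarrow> ('d \<Rightarrow> 'r::finite set) \<Rightarrow> (complex^'r^'n^'d \<Rightarrow> real) \<Rightarrow> bool" where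
  "smooth_objective N R f \<longleftrightarrow>
     (\<exists>W. open W \<and> stiefel_prod N R \<subseteq> W \<and> smooth_on f W) \<and>
     (\<forall>\<omega>\<in>stiefel_prod N R. \<forall>i. smooth_on (restr N R f \<omega> i) UNIV)"

definition block_multiconvex ::
    "('d::finite \<Rightarrow> 'n::finite set) \<Rightarrow> ('d \<Rightarrow> 'r::finite set) \<Rightarrow> (complex^'r^'n^'d \<Rightarrow> real) \<Rightarrow> bool" where
  "block_multiconvex N R f \<longleftrightarrow>
     (\<forall>\<omega>\<in>stiefel_prod N R. \<forall>i. convex_on UNIV (restr N R f \<omega> i))"

definition gradient :: "('a::real_inner \<Rightarrow> real) \<Rightarrow> 'a \<Rightarrow> 'a" where
  "gradient h x = (THE D. GDERIV h x :> D)"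

definition riemannian_grad ::
    "(complex^'r::finite^'n::finite \<Rightarrow> real) \<Rightarrow> complex^'r^'n \<Rightarrow> complex^'r^'n" where
  "riemannian_grad h U = gradient h U - U ** msym (ctranspose U ** gradient h U)"

definition riemannian_grad_prod ::
    "('d::finite \<Rightarrow> 'n::finite set) \<Rightarrow> ('d \<Rightarrow> 'r::finite set) \<Rightarrow> (complex^'r^'n^'d \<Rightarrow> real)
      \<Rightarrow> complex^'r^'n^'d \<Rightarrow> complex^'r^'n^'d" where
  "riemannian_grad_prod N R f \<omega> = (\<chi> i. riemannian_grad (restr N R f \<omega> i) (\<omega> $ i))"

definition stationary_point ::
    "('d::finite \<Rightarrow> 'n::finite set) \<Rightarrow> ('d \<Rightarrow> 'r::finite set) \<Rightarrow> (complex^'r^'n^'d \<Rightarrow> real)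
      \<Rightarrow> complex^'r^'n^'d \<Rightarrow> bool" where
  "stationary_point N R f \<omega> \<longleftrightarrow> \<omega> \<in> stiefel_prod N R \<and> riemannian_grad_prod N R f \<omega> = 0"

definition hermitian_psd :: "complex^'r^'r \<Rightarrow> bool" where
  "hermitian_psd P \<longleftrightarrow> ctranspose P = P \<and>
     (\<forall>x. 0 \<le> Re (\<Sum>a\<in>UNIV. cnj (x $ a) * (P *v x) $ a))"

text \<open>A relation, since the polar factor is not unique for rank-deficient matrices.\<close>

definition polar_factor :: "'n::finite set \<Rightarrow> 'r::finite set \<Rightarrow> complex^'r^'n \<Rightarrow> complex^'r^'n \<Rightarrow> bool" where
  "polar_factor N R X U \<longleftrightarrow> U \<in> stiefel N R \<and>
     (\<exists>P\<in>block_space R R. hermitian_psd P \<and> X = U ** P)"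

text \<open>
  The singular values of an n-by-r matrix with r \<le> n: the square roots of the r eigenvalues of
  the r-by-r matrix X^H X. Eigenvectors are taken without padding entries, as these would
  contribute a spurious eigenvalue 0.
\<close>

definition singular_values :: "'r::finite set \<Rightarrow> complex^'r^'n::finite \<Rightarrow> real set" where
  "singular_values R X = {s. 0 \<le> s \<and> (\<exists>v. v \<noteq> 0 \<and> (\<forall>b. b \<notin> R \<longrightarrow> v $ b = 0) \<and>
     (ctranspose X ** X) *v v = of_real (s\<^sup>2) *s v)}"

definition sigma_min :: "'r::finite set \<Rightarrow> complex^'r^'n::finite \<Rightarrow> real" where
  "sigma_min R X = Min (singular_values R X)"

text \<open>
  In the following, \<open>U k $ i\<close> is the i-th block after sweep k, and \<open>U 0\<close> is the starting point.
\<close>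

definition iterate :: "(nat \<Rightarrow> (complex^'r^'n, 'd::{finite,linorder}) vec) \<Rightarrow> nat \<Rightarrow> 'd
    \<Rightarrow> (complex^'r^'n, 'd) vec" where
  "iterate U k i = (\<chi> j. if j \<le> i then U k $ j else U (k - 1) $ j)"

text \<open>The block i of the tuple in the next definition is ignored by \<^const>\<open>restr\<close>.\<close>

definition sub_objective ::
    "('d::{finite,linorder} \<Rightarrow> 'n::finite set) \<Rightarrow> ('d \<Rightarrow> 'r::finite set) \<Rightarrow> ((complex^'r^'n, 'd) vec \<Rightarrow> real)
      \<Rightarrow> (nat \<Rightarrow> (complex^'r^'n, 'd) vec) \<Rightarrow> nat \<Rightarrow> 'd \<Rightarrow> complex^'r^'n \<Rightarrow> real" where
  "sub_objective N R f U k i =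
     restr N R f (\<chi> j. if j < i then U k $ j else U (k - 1) $ j) i"

definition apdoi ::
    "('d::{finite,linorder} \<Rightarrow> 'n::finite set) \<Rightarrow> ('d \<Rightarrow> 'r::finite set) \<Rightarrow> ((complex^'r^'n, 'd) vec \<Rightarrow> real)
      \<Rightarrow> (nat \<Rightarrow> (complex^'r^'n, 'd) vec) \<Rightarrow> bool" where
  "apdoi N R f U \<longleftrightarrow> U 0 \<in> stiefel_prod N R \<and> f (U 0) > 0 \<and>
     (\<forall>k\<ge>1. \<forall>i. polar_factor (N i) (R i)
        (gradient (sub_objective N R f U k i) (U (k - 1) $ i)) (U k $ i))"

text \<open>Accumulation points of the iterates: limits of subsequences in lexicographic order.\<close>

definition accumulation_point ::
    "(nat \<Rightarrow> 'd::linorder \<Rightarrow> 'a::topological_space) \<Rightarrow> 'a \<Rightarrow> bool" where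
  "accumulation_point w x \<longleftrightarrow> (\<exists>p :: nat \<Rightarrow> nat \<times> 'd.
     (\<forall>m. fst (p m) \<ge> 1) \<and>
     (\<forall>m. (p m, p (Suc m)) \<in> less_than <*lex*> {(i, j). i < j}) \<and>
     (\<lambda>m. w (fst (p m)) (snd (p m))) \<longlonglongrightarrow> x)"

end

theory Submission
  imports Defs
begin

text \<open>
  A block update replaces the block \<open>V\<close> by the polar factor \<open>U\<close> of the gradient
  \<open>X = U P\<close> at \<open>V\<close>. Expanding the Hermitian form of \<open>P\<close> at \<open>U - V\<close> with
  \<open>U\<^sup>H U = V\<^sup>H V\<close> gives
  \<open>\<langle>X, U - V\<rangle> = (1/2) \<langle>(U - V) P, U - V\<rangle> \<ge> (\<sigma>_min(X) / 2) \<parallel>U - V\<parallel>\<^sup>2\<close>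
  (\<open>polar_factor_gain\<close>), since the smallest eigenvalue of \<open>P\<close> is a singular value of \<open>X\<close>.
  A convex function lies above its tangent, so every update increases the objective by at least
  \<open>\<delta>/2\<close> times the squared length of the step (\<open>block_step_gain\<close>): the method ascends. The
  objective is bounded above on the compact product of Stiefel manifolds, hence the lengths of the
  steps tend to 0 (\<open>steps_vanish\<close>).

  Consequently, if iterates with growing sweep numbers converge to \<open>\<omega>\<close>, then so do all the other
  partially updated tuples of the same sweeps, both before and after the update of any given
  block \<open>i\<close>. The gradient in block \<open>i\<close> depends continuously on the whole tuple
  (\<open>continuous_on_block_gradient\<close>). That the new block is a polar factor of the gradient \<open>X\<close>
  implies the two closed conditions \<open>U (U\<^sup>H X) = X\<close> and \<open>(U\<^sup>H X)\<^sup>H = U\<^sup>H X\<close>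
  (\<open>polar_factor_recovered\<close>). In the limit they hold for \<open>U = \<omega>\<^sub>i\<close> and the gradient \<open>X\<close> at
  \<open>\<omega>\<close>, and together they say that the Riemannian gradient \<open>X - U sym(U\<^sup>H X)\<close> vanishes.
\<close>

section \<open>Matrix algebra in the Frobenius inner product\<close>

lemma tendsto_matrix_mult [tendsto_intros]:
  fixes A :: "'a \<Rightarrow> complex^'k::finite^'m::finite" and B :: "'a \<Rightarrow> complex^'n::finite^'k"
  assumes "(A \<longlongrightarrow> a) F" "(B \<longlongrightarrow> b) F"
  shows "((\<lambda>x. A x ** B x) \<longlongrightarrow> a ** b) F"
  unfolding matrix_matrix_mult_def by (intro tendsto_intros assms)

lemma tendsto_ctranspose [tendsto_intros]:
  fixes A :: "'a \<Rightarrow> complex^'k::finite^'m::finite"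
  assumes "(A \<longlongrightarrow> a) F"
  shows "((\<lambda>x. ctranspose (A x)) \<longlongrightarrow> ctranspose a) F"
  unfolding ctranspose_def by (intro tendsto_intros assms)

lemma matrix_mult_diff_left:
  fixes A B :: "complex^'k::finite^'m::finite"
  shows "(A - B) ** C = A ** C - B ** C"
  by (simp add: matrix_matrix_mult_def vec_eq_iff left_diff_distrib sum_subtractf)

lemma ctranspose_mult: "ctranspose (A ** B) = ctranspose B ** ctranspose A"
  by (simp add: ctranspose_def matrix_matrix_mult_def vec_eq_iff mult.commute)

lemma ctranspose_ctranspose [simp]: "ctranspose (ctranspose A) = A"
  by (simp add: ctranspose_def vec_eq_iff)

lemma inner_mult_left:
  fixes A :: "complex^'k::finite^'m::finite" and B :: "complex^'n::finite^'k"
  shows "inner (A ** B) C = inner B (ctranspose A ** C)"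
  by (simp add: inner_eq_Re_trace ctranspose_mult matrix_mul_assoc)

lemma inner_mult_right:
  fixes A :: "complex^'k::finite^'m::finite" and B :: "complex^'n::finite^'k"
  shows "inner (A ** B) C = inner A (C ** ctranspose B)"
proof -
  have "inner (A ** B) C = Re (trace (ctranspose B ** (ctranspose A ** C)))"
    by (simp add: inner_eq_Re_trace ctranspose_mult matrix_mul_assoc)
  also have "\<dots> = inner A (C ** ctranspose B)"
    by (subst trace_mul_sym) (simp add: inner_eq_Re_trace matrix_mul_assoc)
  finally show ?thesis .
qed

lemma inner_complex_eq: "inner x y = Re (cnj x * y)"
  by (simp add: inner_complex_def)

lemma inner_matrix_vector_mult:
  fixes A :: "complex^'n::finite^'m::finite"
  shows "inner x (A *v y) = inner (ctranspose A *v x) y"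
proof -
  have "inner x (A *v y) = (\<Sum>a\<in>UNIV. \<Sum>b\<in>UNIV. Re (cnj (x $ a) * (A $ a $ b * y $ b)))"
    by (simp only: inner_vec_def inner_complex_eq matrix_vector_mult_def vec_lambda_beta
        sum_distrib_left Re_sum)
  also have "\<dots> = (\<Sum>b\<in>UNIV. \<Sum>a\<in>UNIV. Re (cnj (x $ a) * (A $ a $ b * y $ b)))"
    by (rule sum.swap)
  also have "\<dots> = inner (ctranspose A *v x) y"
    by (simp only: inner_vec_def inner_complex_eq matrix_vector_mult_def ctranspose_def
        vec_lambda_beta sum_distrib_right Re_sum cnj_sum complex_cnj_mult complex_cnj_cnj)
       (simp only: mult_ac)
  finally show ?thesis .
qed

lemma linear_matrix_vector_mult_complex:
  "linear (\<lambda>x :: complex^'n::finite. A *v x)"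
  by (rule linearI)
     (simp_all add: matrix_vector_mult_def vec_eq_iff scaleR_sum_right sum.distrib distrib_left)

lemma mult_id_on:
  fixes P :: "complex^'n::finite^'r::finite"
  assumes "P \<in> block_space R Q"
  shows "id_on R ** P = P"
proof -
  have "(\<Sum>c\<in>UNIV. (if a = c \<and> a \<in> R then 1 else 0) * P $ c $ b) = P $ a $ b" for a b
    using assms by (cases "a \<in> R") (auto simp: block_space_def if_distrib[of "\<lambda>x. x * _"] cong: if_cong)
  then show ?thesis by (simp add: id_on_def matrix_matrix_mult_def vec_eq_iff)
qed

text \<open>
  The conjugated rows of \<open>D\<close> enter because \<open>P\<close> acts on rows from the right, while positivity of
  \<open>P\<close> and its eigenvalues are expressed by its action on columns from the left.
\<close>

lemma inner_mult_rows:
  fixes D :: "complex^'r::finite^'n::finite" and P :: "complex^'r^'r"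
  shows "inner (D ** P) D = (\<Sum>a\<in>UNIV. inner (\<chi> b. cnj (D $ a $ b)) (P *v (\<chi> b. cnj (D $ a $ b))))"
proof -
  have "inner ((D ** P) $ a) (D $ a) =
      inner (\<chi> b. cnj (D $ a $ b)) (P *v (\<chi> b. cnj (D $ a $ b)))" for a
  proof -
    have "inner ((D ** P) $ a) (D $ a) = inner (D $ a) ((D ** P) $ a)" by (rule inner_commute)
    also have "\<dots> = (\<Sum>b\<in>UNIV. \<Sum>c\<in>UNIV. Re (cnj (D $ a $ b) * (D $ a $ c * P $ c $ b)))"
      by (simp only: inner_vec_def inner_complex_eq matrix_matrix_mult_def vec_lambda_beta
          sum_distrib_left Re_sum)
    also have "\<dots> = (\<Sum>c\<in>UNIV. \<Sum>b\<in>UNIV. Re (cnj (D $ a $ b) * (D $ a $ c * P $ c $ b)))"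
      by (rule sum.swap)
    also have "\<dots> = inner (\<chi> b. cnj (D $ a $ b)) (P *v (\<chi> b. cnj (D $ a $ b)))"
      by (simp only: inner_vec_def inner_complex_eq matrix_vector_mult_def vec_lambda_beta
          sum_distrib_left Re_sum complex_cnj_cnj mult_ac)
    finally show ?thesis .
  qed
  then show ?thesis
    by (simp add: inner_vec_def[of "D ** P"])
qed

section \<open>Smallest singular value\<close>

text \<open>
  The Rayleigh quotient attains its minimum on the unit sphere of \<open>S\<close>, and the minimizer \<open>v\<close> is an
  eigenvector: the quadratic form of \<open>A - \<mu>\<close> is nonnegative on \<open>S\<close> and zero at \<open>v\<close>, so its
  derivative at \<open>v\<close> in the direction \<open>A v - \<mu> v\<close> vanishes, and this derivative is
  \<open>2 \<parallel>A v - \<mu> v\<parallel>\<^sup>2\<close>.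
\<close>

lemma selfadjoint_min_eigenvector:
  fixes A :: "'a::euclidean_space \<Rightarrow> 'a"
  assumes lin: "linear A" and sym: "\<And>x y. inner x (A y) = inner (A x) y"
    and S: "subspace S" "\<And>x. x \<in> S \<Longrightarrow> A x \<in> S" "S \<noteq> {0}"
  obtains v \<mu> where "v \<in> S" "v \<noteq> 0" "A v = \<mu> *\<^sub>R v" "\<And>w. w \<in> S \<Longrightarrow> \<mu> * inner w w \<le> inner w (A w)"
proof -
  let ?K = "S \<inter> sphere 0 1"
  obtain s where s: "s \<in> S" "s \<noteq> 0" using S(1,3) subspace_0 by blast
  have "(1 / norm s) *\<^sub>R s \<in> ?K" using s S(1) by (simp add: subspace_scale)
  then have ne: "?K \<noteq> {}" by blast
  have "compact ?K" using S(1) by (simp add: closed_Int_compact closed_subspace)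
  moreover have "continuous_on ?K (\<lambda>v. inner v (A v))"
    using lin by (intro continuous_intros linear_continuous_on) (simp add: linear_conv_bounded_linear)
  ultimately obtain v where v: "v \<in> ?K" and vmin: "\<And>w. w \<in> ?K \<Longrightarrow> inner v (A v) \<le> inner w (A w)"
    using continuous_attains_inf[OF _ ne] by blast
  define \<mu> where "\<mu> = inner v (A v)"
  have nv: "inner v v = 1" "v \<in> S" using v by (auto simp: norm_eq_1)
  have q: "\<mu> * inner w w \<le> inner w (A w)" if w: "w \<in> S" for w
  proof (cases "w = 0")
    case False
    have "(1 / norm w) *\<^sub>R w \<in> ?K" using w False S(1) by (simp add: subspace_scale)
    from vmin[OF this] have "\<mu> \<le> inner w (A w) / (norm w)\<^sup>2"
      by (simp add: \<mu>_def linear_scale[OF lin] power2_eq_square)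
    then show ?thesis using False by (simp add: pos_le_divide_eq dot_square_norm)
  qed simp
  define w where "w = A v - \<mu> *\<^sub>R v"
  have wS: "w \<in> S" unfolding w_def using nv S by (simp add: subspace_diff subspace_scale)
  define c where "c = inner w (A w) - \<mu> * inner w w"
  have c: "c \<ge> 0" using q[OF wS] by (simp add: c_def)
  have ineq: "0 \<le> 2 * t * inner w w + t\<^sup>2 * c" for t
  proof -
    have "v + t *\<^sub>R w \<in> S" using nv wS S(1) by (simp add: subspace_add subspace_scale)
    from q[OF this] have "0 \<le> inner (v + t *\<^sub>R w) (A (v + t *\<^sub>R w) - \<mu> *\<^sub>R (v + t *\<^sub>R w))"
      by (simp add: inner_diff_right)
    also have "A (v + t *\<^sub>R w) - \<mu> *\<^sub>R (v + t *\<^sub>R w) = w + t *\<^sub>R (A w - \<mu> *\<^sub>R w)"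
      by (simp add: w_def linear_add[OF lin] linear_scale[OF lin] linear_diff[OF lin] algebra_simps)
    also have "inner (v + t *\<^sub>R w) \<dots> = inner v w + t * (inner v (A w - \<mu> *\<^sub>R w) + inner w w) + t\<^sup>2 * c"
      by (simp add: inner_add_left inner_add_right c_def inner_diff_right power2_eq_square algebra_simps)
    also have "inner v w = 0" by (simp add: w_def inner_diff_right \<mu>_def nv)
    also have "inner v (A w - \<mu> *\<^sub>R w) = inner w w"
    proof -
      have "inner v (A w - \<mu> *\<^sub>R w) = inner (A v - \<mu> *\<^sub>R v) w"
        by (simp add: inner_diff_right inner_diff_left sym)
      then show ?thesis by (simp add: w_def)
    qed
    finally show ?thesis by (simp add: algebra_simps)
  qed
  have "inner w w = 0"
  proof (rule ccontr)
    assume "inner w w \<noteq> 0"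
    then have pos: "inner w w > 0" by simp
    (* small enough in absolute value for the linear term to dominate; c may be 0, hence c + 1 *)
    define t where "t = - inner w w / (c + 1)"
    have "t < 0" using pos c by (simp add: t_def divide_neg_pos)
    have "2 * t * inner w w + t\<^sup>2 * c = t * (2 * inner w w + t * c)"
      by (simp add: power2_eq_square algebra_simps)
    moreover have "2 * inner w w + t * c > 0"
    proof -
      have "inner w w * c \<le> inner w w * (c + 1)" using pos by simp
      then have "inner w w * c / (c + 1) \<le> inner w w" using c by (simp add: pos_divide_le_eq)
      then have "inner w w * c / (c + 1) < 2 * inner w w" using pos by linarith
      then show ?thesis by (simp add: t_def)
    qed
    ultimately show False using ineq[of t] \<open>t < 0\<close> by (simp add: zero_le_mult_iff)
  qed
  then have "A v = \<mu> *\<^sub>R v" by (simp add: w_def)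
  moreover have "v \<noteq> 0" using nv by auto
  ultimately show ?thesis using that nv q by blast
qed

lemma of_real_vector_scale: "of_real c *s (v :: complex^'n) = c *\<^sub>R v"
  by (simp add: vec_eq_iff) (simp add: scaleR_conv_of_real)

text \<open>
  Eigenvectors of \<open>X\<^sup>H X\<close> for different eigenvalues are orthogonal, so there are at most as many
  eigenvalues as dimensions. Without finiteness the minimum that defines \<^const>\<open>sigma_min\<close> need
  not be a lower bound of the singular values.
\<close>

lemma finite_singular_values: "finite (singular_values R X)"
proof -
  let ?M = "ctranspose X ** X"
  have sym: "inner x (?M *v y) = inner (?M *v x) y" for x y
    by (simp add: inner_matrix_vector_mult ctranspose_mult)
  have "\<exists>v. v \<noteq> 0 \<and> ?M *v v = (s\<^sup>2) *\<^sub>R v" if "s \<in> singular_values R X" for s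
    using that by (auto simp only: singular_values_def of_real_vector_scale mem_Collect_eq)
  then obtain e where e: "\<And>s. s \<in> singular_values R X \<Longrightarrow> e s \<noteq> 0 \<and> ?M *v e s = (s\<^sup>2) *\<^sub>R e s"
    by metis
  have orth: "inner (e s) (e t) = 0"
    if "s \<in> singular_values R X" "t \<in> singular_values R X" "s \<noteq> t" for s t
  proof -
    have "s\<^sup>2 \<noteq> t\<^sup>2" using that by (auto simp: singular_values_def power2_eq_iff_nonneg)
    moreover have "s\<^sup>2 * inner (e s) (e t) = t\<^sup>2 * inner (e s) (e t)"
      using sym[of "e s" "e t"] e[OF that(1)] e[OF that(2)]
      by (metis inner_scaleR_left inner_scaleR_right)
    ultimately show ?thesis by simp
  qed
  have "inj_on e (singular_values R X)"
  proof (rule inj_onI, rule ccontr)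
    fix s t assume *: "s \<in> singular_values R X" "t \<in> singular_values R X" "e s = e t" "s \<noteq> t"
    then show False using orth[of s t] e[of t] by simp
  qed
  moreover have "finite (e ` singular_values R X)"
  proof (rule independent_imp_finite, rule pairwise_orthogonal_independent)
    show "pairwise orthogonal (e ` singular_values R X)"
      unfolding pairwise_def orthogonal_def using orth by blast
    show "0 \<notin> e ` singular_values R X" using e by force
  qed
  ultimately show ?thesis by (rule finite_imageD[rotated])
qed

text \<open>
  As \<open>X\<^sup>H X = P\<^sup>2\<close>, the smallest eigenvalue of \<open>P\<close> is a singular value of \<open>X\<close>. Vectors are
  restricted to the support \<open>R\<close> because \<open>P\<close> is zero on the padding.
\<close>

lemma polar_factor_coercive:
  fixes X :: "complex^'r::finite^'n::finite"
  assumes U: "U \<in> stiefel N R" and P: "P \<in> block_space R R" "hermitian_psd P" and X: "X = U ** P"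
    and R: "R \<noteq> {}" and w: "\<And>b. b \<notin> R \<Longrightarrow> w $ b = 0"
  shows "sigma_min R X * inner w w \<le> inner w (P *v w)"
proof -
  define S where "S = {v :: complex^'r. \<forall>b. b \<notin> R \<longrightarrow> v $ b = 0}"
  have PH: "ctranspose P = P" using P by (simp add: hermitian_psd_def)
  have psd: "0 \<le> inner x (P *v x)" for x
  proof -
    have "inner x (P *v x) = Re (\<Sum>a\<in>UNIV. cnj (x $ a) * (P *v x) $ a)"
      by (simp only: inner_vec_def inner_complex_eq Re_sum)
    then show ?thesis using P(2) by (simp add: hermitian_psd_def)
  qed
  have "subspace S" by (auto simp: subspace_def S_def)
  moreover have "P *v x \<in> S" for x
    using P(1) by (simp add: S_def block_space_def matrix_vector_mult_def)
  moreover have "S \<noteq> {0}"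
  proof -
    obtain b where "b \<in> R" using R by blast
    then have "axis b 1 \<in> S" by (auto simp: S_def axis_def)
    then show ?thesis by (metis axis_eq_0_iff singletonD zero_neq_one)
  qed
  ultimately obtain v \<mu> where v: "v \<in> S" "v \<noteq> 0" "P *v v = \<mu> *\<^sub>R v"
      and min: "\<And>w. w \<in> S \<Longrightarrow> \<mu> * inner w w \<le> inner w (P *v w)"
    using selfadjoint_min_eigenvector[OF linear_matrix_vector_mult_complex, of P S] PH
    by (metis inner_matrix_vector_mult)
  have "0 \<le> \<mu> * inner v v" using psd[of v] v by simp
  moreover have "0 < inner v v" using v(2) by simp
  ultimately have "0 \<le> \<mu>" by (simp only: zero_le_mult_iff) linarith
  have "ctranspose X ** X = P ** ((ctranspose U ** U) ** P)"
    by (simp add: X ctranspose_mult PH matrix_mul_assoc)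
  also have "\<dots> = P ** P" using U P(1) by (simp add: stiefel_def mult_id_on)
  finally have "(ctranspose X ** X) *v v = P *v (P *v v)" by (simp add: matrix_vector_mul_assoc)
  also have "\<dots> = \<mu>\<^sup>2 *\<^sub>R v"
    using v by (simp add: linear_scale[OF linear_matrix_vector_mult_complex] power2_eq_square)
  also have "\<dots> = of_real (\<mu>\<^sup>2) *s v" by (rule of_real_vector_scale[symmetric])
  finally have "\<mu> \<in> singular_values R X"
    using v \<open>0 \<le> \<mu>\<close> by (auto simp: singular_values_def S_def)
  then have "sigma_min R X \<le> \<mu>" unfolding sigma_min_def by (rule Min_le[OF finite_singular_values])
  then have "sigma_min R X * inner w w \<le> \<mu> * inner w w" by (simp add: mult_right_mono)
  also have "\<dots> \<le> inner w (P *v w)" using w by (intro min) (simp add: S_def)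
  finally show ?thesis .
qed

text \<open>
  This sharpens the fact that the polar factor \<open>U\<close> maximizes the linear function \<open>\<langle>X, _\<rangle>\<close> over the
  Stiefel manifold. With \<open>D = U - V\<close>, the terms \<open>\<langle>U P, U\<rangle>\<close> and \<open>\<langle>V P, V\<rangle>\<close> of \<open>\<langle>D P, D\<rangle>\<close> agree
  as \<open>U\<^sup>H U = V\<^sup>H V\<close>, and the mixed terms agree as \<open>P\<close> is Hermitian; so
  \<open>\<langle>D P, D\<rangle> = 2 \<langle>X, D\<rangle>\<close>, which is then bounded from below row by row.
\<close>

lemma polar_factor_gain:
  fixes X :: "complex^'r::finite^'n::finite"
  assumes pf: "polar_factor N R X U" and V: "V \<in> stiefel N R" and R: "R \<noteq> {}"
  shows "sigma_min R X / 2 * (norm (U - V))\<^sup>2 \<le> inner X (U - V)"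
proof -
  obtain P where U: "U \<in> stiefel N R" and P: "P \<in> block_space R R" "hermitian_psd P"
    and X: "X = U ** P" using pf by (auto simp: polar_factor_def)
  define D where "D = U - V"
  have PH: "ctranspose P = P" using P by (simp add: hermitian_psd_def)
  have VP: "inner (V ** P) V = inner (U ** P) U"
    using U V by (simp add: inner_mult_left stiefel_def)
  have "inner (V ** P) U = inner (U ** P) V"
    using inner_mult_right[of V P U] by (simp add: PH inner_commute)
  with VP have eq: "inner (D ** P) D = 2 * inner X D"
    by (simp add: D_def X matrix_mult_diff_left inner_diff_left inner_diff_right)
  have D0: "D $ a $ b = 0" if "b \<notin> R" for a b
    using U V that by (simp add: D_def stiefel_def block_space_def)
  have "sigma_min R X * (norm D)\<^sup>2 =
      (\<Sum>a\<in>UNIV. sigma_min R X * inner (\<chi> b. cnj (D $ a $ b)) (\<chi> b. cnj (D $ a $ b)))"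
    by (simp add: power2_norm_eq_inner inner_vec_def inner_complex_def sum_distrib_left)
  also have "\<dots> \<le> (\<Sum>a\<in>UNIV. inner (\<chi> b. cnj (D $ a $ b)) (P *v (\<chi> b. cnj (D $ a $ b))))"
    by (intro sum_mono polar_factor_coercive[OF U P X R]) (simp add: D0)
  also have "\<dots> = 2 * inner X D" by (simp add: eq flip: inner_mult_rows)
  finally show ?thesis by (simp add: D_def)
qed

section \<open>Compactness of the Stiefel product\<close>

lemma crop_stiefel [simp]: "X \<in> stiefel N R \<Longrightarrow> crop N R X = X"
  by (auto simp: stiefel_def block_space_def crop_def vec_eq_iff)

lemma norm_stiefel:
  assumes "X \<in> stiefel N R" shows "norm X = sqrt (Re (trace (id_on R)))"
  using assms by (simp add: norm_eq_sqrt_inner inner_eq_Re_trace stiefel_def)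

lemma closed_stiefel: "closed (stiefel N R)"
  unfolding closed_sequential_limits
proof (intro allI impI, elim conjE)
  fix X and l :: "complex^'a^'b"
  assume X: "\<forall>n. X n \<in> stiefel N R" and lim: "X \<longlonglongrightarrow> l"
  have "l $ a $ b = 0" if "a \<notin> N \<or> b \<notin> R" for a b
  proof (rule LIMSEQ_unique)
    show "(\<lambda>n. X n $ a $ b) \<longlonglongrightarrow> l $ a $ b" by (intro tendsto_intros lim)
    show "(\<lambda>n. X n $ a $ b) \<longlonglongrightarrow> 0" using X that by (simp add: stiefel_def block_space_def)
  qed
  moreover have "ctranspose l ** l = id_on R"
  proof (rule LIMSEQ_unique)
    show "(\<lambda>n. ctranspose (X n) ** X n) \<longlonglongrightarrow> ctranspose l ** l" by (intro tendsto_intros lim)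
    show "(\<lambda>n. ctranspose (X n) ** X n) \<longlonglongrightarrow> id_on R" using X by (simp add: stiefel_def)
  qed
  ultimately show "l \<in> stiefel N R" by (auto simp: stiefel_def block_space_def)
qed

text \<open>
  All points of one Stiefel manifold have the same Frobenius norm, which gives boundedness.
\<close>

lemma compact_stiefel_prod: "compact (stiefel_prod N R)"
proof -
  have "closed (stiefel_prod N R)"
    unfolding stiefel_prod_def
    by (intro closed_Collect_all closed_vimage[OF closed_stiefel, unfolded vimage_def] continuous_intros)
  moreover have "bounded (stiefel_prod N R)"
  proof (rule boundedI)
    fix x assume "x \<in> stiefel_prod N R"
    then have eq: "norm (x $ i) = sqrt (Re (trace (id_on (R i))))" for i
      using norm_stiefel[of "x $ i" "N i" "R i"] by (simp add: stiefel_prod_def)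
    have "norm x = L2_set (\<lambda>i. norm (x $ i)) UNIV" by (rule norm_vec_def)
    also have "\<dots> \<le> (\<Sum>i\<in>UNIV. norm (x $ i))" by (rule L2_set_le_sum) simp
    finally show "norm x \<le> (\<Sum>i\<in>UNIV. sqrt (Re (trace (id_on (R i)))))" by (simp only: eq)
  qed
  ultimately show ?thesis by (simp add: compact_eq_bounded_closed)
qed

section \<open>Gradients\<close>

lemma gradient_eq: "GDERIV h x :> D \<Longrightarrow> gradient h x = D"
  unfolding gradient_def
proof (rule the_equality)
  fix E assume E: "GDERIV h x :> E" and D: "GDERIV h x :> D"
  have "(\<lambda>v. inner v E) = (\<lambda>v. inner v D)"
    using E D unfolding gderiv_def by (rule has_derivative_unique)
  then have "inner (E - D) E = inner (E - D) D" by metis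
  then have "inner (E - D) (E - D) = 0" by (simp add: inner_diff_right)
  then show "E = D" by simp
qed

text \<open>
  The one-dimensional tangent inequality along the line through \<open>x\<close> and \<open>y\<close>.
\<close>

lemma convex_above_tangent:
  fixes h :: "'a::real_inner \<Rightarrow> real"
  assumes conv: "convex_on UNIV h" and D: "GDERIV h x :> D"
  shows "h x + inner D (y - x) \<le> h y"
proof -
  define g where "g t = h (x + t *\<^sub>R (y - x))" for t
  have "convex_on UNIV g"
  proof (rule convex_onI)
    fix t a b :: real assume t: "0 < t" "t < 1"
    have "x + ((1 - t) *\<^sub>R a + t *\<^sub>R b) *\<^sub>R (y - x)
        = (1 - t) *\<^sub>R (x + a *\<^sub>R (y - x)) + t *\<^sub>R (x + b *\<^sub>R (y - x))"
      by (simp add: algebra_simps)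
    then show "g ((1 - t) *\<^sub>R a + t *\<^sub>R b) \<le> (1 - t) * g a + t * g b"
      unfolding g_def using convex_onD[OF conv, of t] t by simp
  qed simp
  moreover have "(g has_field_derivative inner (y - x) D) (at 0)"
  proof -
    have "((\<lambda>t. x + t *\<^sub>R (y - x)) has_derivative (\<lambda>t. t *\<^sub>R (y - x))) (at 0)"
      by (auto intro!: derivative_eq_intros)
    moreover have "(h has_derivative (\<lambda>v. inner v D)) (at (x + 0 *\<^sub>R (y - x)))"
      using D by (simp add: gderiv_def)
    ultimately have "(g has_derivative (\<lambda>t. inner (t *\<^sub>R (y - x)) D)) (at 0)"
      unfolding g_def by (rule has_derivative_compose)
    moreover have "(\<lambda>t. inner (t *\<^sub>R (y - x)) D) = (*) (inner (y - x) D)"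
      by (simp add: fun_eq_iff)
    ultimately show ?thesis by (simp add: has_field_derivative_def)
  qed
  ultimately have "inner (y - x) D * (1 - 0) \<le> g 1 - g 0"
    by (intro convex_on_imp_above_tangent[where A = UNIV]) auto
  then show ?thesis by (simp add: g_def inner_commute)
qed

text \<open>
  The block \<open>i\<close> of the gradient of \<open>f\<close> at \<open>x\<close>, cropped to the unpadded entries, written in
  coordinates. As a function of the whole tuple its continuity can be read off from that of the
  directional derivatives of \<open>f\<close>, which is what the limit needs.
\<close>

definition block_gradient ::
    "('d::finite \<Rightarrow> 'n::finite set) \<Rightarrow> ('d \<Rightarrow> 'r::finite set) \<Rightarrow> (complex^'r^'n^'d \<Rightarrow> real) \<Rightarrow> 'd
      \<Rightarrow> complex^'r^'n^'d \<Rightarrow> complex^'r^'n" where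
  "block_gradient N R f i x =
     (\<Sum>b\<in>Basis. frechet_derivative f (at x) (axis i (crop (N i) (R i) b)) *\<^sub>R b)"

lemma linear_crop: "linear (crop N R)"
  by (rule linearI) (auto simp: crop_def vec_eq_iff)

text \<open>
  At a point of the Stiefel product the cropping fixes the block \<open>i\<close>, so the restricted function is
  \<open>f\<close> composed with an affine map through \<open>x\<close>, and the chain rule applies.
\<close>

lemma GDERIV_restr:
  fixes f :: "complex^'r::finite^'n::finite^'d::finite \<Rightarrow> real"
  assumes x: "x \<in> stiefel_prod N R" and f: "f differentiable (at x)"
  shows "GDERIV (restr N R f x i) (x $ i) :> block_gradient N R f i x"
proof -
  define L where "L V = axis i (crop (N i) (R i) V)" for V :: "complex^'r^'n"
  have linL: "linear L"
    unfolding L_def using linear_crop[of "N i" "R i"]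
    by (intro linearI) (auto simp: axis_def vec_eq_iff linear_add linear_scale)
  let ?F = "frechet_derivative f (at x)"
  have F: "(f has_derivative ?F) (at x)" using f by (simp add: frechet_derivative_works)
  have T: "(\<chi> j. if j = i then crop (N i) (R i) X else x $ j) = x + L (X - x $ i)" for X
    using x crop_stiefel[of "x $ i" "N i" "R i"]
    by (auto simp: L_def axis_def vec_eq_iff stiefel_prod_def linear_diff[OF linear_crop])
  have "((\<lambda>X. x + L (X - x $ i)) has_derivative (\<lambda>h. L h)) (at (x $ i))"
    using linL by (auto intro!: derivative_eq_intros bounded_linear.has_derivative[of L]
        simp: linear_conv_bounded_linear)
  moreover have "(f has_derivative ?F) (at (x + L (x $ i - x $ i)))"
    using F linear_0[OF linL] by simp
  ultimately have "((\<lambda>X. f (x + L (X - x $ i))) has_derivative (\<lambda>h. ?F (L h))) (at (x $ i))"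
    by (rule has_derivative_compose)
  moreover have "?F (L h) = inner h (block_gradient N R f i x)" for h
  proof -
    have lin: "linear (\<lambda>h. ?F (L h))"
      using linear_compose[OF linL has_derivative_linear[OF F]] by (simp add: o_def)
    have "?F (L h) = ?F (L (\<Sum>b\<in>Basis. inner h b *\<^sub>R b))" by (simp add: euclidean_representation)
    also have "\<dots> = (\<Sum>b\<in>Basis. inner h b * ?F (L b))"
      by (simp add: linear_sum[OF lin] linear_scale[OF lin])
    finally show ?thesis
      by (simp add: block_gradient_def L_def inner_sum_right mult.commute)
  qed
  ultimately show ?thesis by (simp add: gderiv_def restr_def[abs_def] T)
qed

lemma continuous_on_block_gradient:
  assumes "smooth_on f W"
  shows "continuous_on W (block_gradient N R f i)"
proof -
  have "ck_on (Suc 0) f W" using assms by (simp add: smooth_on_def)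
  then have "continuous_on W (\<lambda>x. frechet_derivative f (at x) v)" for v
    by (simp add: ck_on.simps)
  then show ?thesis unfolding block_gradient_def by (intro continuous_intros)
qed

lemma GDERIV_restr_smooth:
  assumes "x \<in> stiefel_prod N R" "open W" "stiefel_prod N R \<subseteq> W" "smooth_on f W"
  shows "GDERIV (restr N R f x i) (x $ i) :> block_gradient N R f i x"
proof (rule GDERIV_restr[OF assms(1)])
  have "ck_on (Suc 0) f W" using assms(4) by (simp add: smooth_on_def)
  then show "f differentiable (at x)" using assms by (auto simp: ck_on.simps)
qed

section \<open>Increase of the objective\<close>

lemma block_step_gain:
  assumes x: "x \<in> stiefel_prod N R" and W: "open W" "stiefel_prod N R \<subseteq> W" "smooth_on f W"
    and conv: "block_multiconvex N R f" and R: "R i \<noteq> {}"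
    and pf: "polar_factor (N i) (R i) (block_gradient N R f i x) V"
  shows "f x + sigma_min (R i) (block_gradient N R f i x) / 2 * (norm (V - x $ i))\<^sup>2
           \<le> f (\<chi> j. if j = i then V else x $ j)"
proof -
  let ?h = "restr N R f x i" and ?G = "block_gradient N R f i x"
  have V: "V \<in> stiefel (N i) (R i)" using pf by (simp add: polar_factor_def)
  have xi: "x $ i \<in> stiefel (N i) (R i)" using x by (simp add: stiefel_prod_def)
  have "(\<chi> j. if j = i then x $ i else x $ j) = x" by (simp add: vec_eq_iff)
  then have hx: "?h (x $ i) = f x" using xi by (simp add: restr_def cong: if_cong)
  have hV: "?h V = f (\<chi> j. if j = i then V else x $ j)" using V by (simp add: restr_def cong: if_cong)
  have "?h (x $ i) + inner ?G (V - x $ i) \<le> ?h V"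
    using conv x by (intro convex_above_tangent GDERIV_restr_smooth[OF x W]) (simp add: block_multiconvex_def)
  with polar_factor_gain[OF pf xi R] show ?thesis by (simp add: hx hV)
qed

text \<open>
  The tuple in sweep \<open>k\<close> in which exactly the blocks in \<open>A\<close> have been updated. Arbitrary sets
  \<open>A\<close> give one notation for the tuples before and after an update and for complete sweeps.
\<close>

definition partial_sweep ::
    "(nat \<Rightarrow> (complex^'r^'n, 'd::finite) vec) \<Rightarrow> nat \<Rightarrow> 'd set \<Rightarrow> (complex^'r^'n, 'd) vec" where
  "partial_sweep U k A = (\<chi> j. if j \<in> A then U k $ j else U (k - 1) $ j)"

lemma iterate_partial_sweep: "iterate U k i = partial_sweep U k {..i}"
  by (simp add: iterate_def partial_sweep_def)

lemma sub_objective_partial_sweep: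
  "sub_objective N R f U k i = restr N R f (partial_sweep U k {..<i}) i"
  by (simp add: sub_objective_def partial_sweep_def)

text \<open>
  Telescoping along the finite linear order. The induction adds maximal elements to down-closed
  sets, since these are the initial segments that occur in the steps.
\<close>

lemma sum_gains_along_order:
  fixes F :: "'d::{finite,linorder} set \<Rightarrow> real"
  assumes step: "\<And>i. F {..<i} + c i \<le> F {..i}"
  shows "F {} + sum c UNIV \<le> F UNIV"
proof -
  have "(\<forall>a\<in>A. {..a} \<subseteq> A) \<longrightarrow> F {} + sum c A \<le> F A" if "finite A" for A
    using that
  proof (induction A rule: finite_linorder_max_induct)
    case (insert b A)
    show ?case
    proof
      assume down: "\<forall>a\<in>insert b A. {..a} \<subseteq> insert b A"
      have A: "A = {..<b}" using down insert.hyps(2) by (auto simp: less_le)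
      then have bA: "insert b A = {..b}" by auto
      have "F {} + sum c A \<le> F A" using insert.IH unfolding A by auto
      moreover have "sum c (insert b A) = c b + sum c A" using A by simp
      moreover have "F A + c b \<le> F (insert b A)" unfolding bA using step[of b] by (simp only: A)
      ultimately show "F {} + sum c (insert b A) \<le> F (insert b A)" by linarith
    qed
  qed simp
  from this[of UNIV] show ?thesis by simp
qed

lemma partial_sweep_stiefel:
  assumes "\<And>k. U k \<in> stiefel_prod N R"
  shows "partial_sweep U k A \<in> stiefel_prod N R"
  using assms by (simp add: partial_sweep_def stiefel_prod_def)

text \<open>
  An increasing bounded sequence converges, so its increments tend to 0, and they dominate the
  squared steps.
\<close>

lemma steps_vanish:
  fixes U :: "nat \<Rightarrow> 'a::real_normed_vector^'d::finite"
  assumes gain: "\<And>k. F (U k) + c * (\<Sum>i\<in>UNIV. (norm (U (Suc k) $ i - U k $ i))\<^sup>2) \<le> F (U (Suc k))"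
    and c: "0 < c" and bdd: "\<And>k. F (U k) \<le> (B::real)"
  shows "(\<lambda>k. U (Suc k) $ i - U k $ i) \<longlonglongrightarrow> 0"
proof -
  have le: "c * (norm (U (Suc k) $ i - U k $ i))\<^sup>2 \<le> F (U (Suc k)) - F (U k)" for k
  proof -
    have "(norm (U (Suc k) $ i - U k $ i))\<^sup>2 \<le> (\<Sum>i\<in>UNIV. (norm (U (Suc k) $ i - U k $ i))\<^sup>2)"
      by (rule member_le_sum) auto
    then have "c * (norm (U (Suc k) $ i - U k $ i))\<^sup>2 \<le> c * (\<Sum>i\<in>UNIV. (norm (U (Suc k) $ i - U k $ i))\<^sup>2)"
      using c by (simp add: mult_left_mono)
    with gain[of k] show ?thesis by linarith
  qed
  have "incseq (\<lambda>k. F (U k))"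
  proof (rule incseq_SucI)
    fix k show "F (U k) \<le> F (U (Suc k))"
      using order_trans[OF _ le[of k], of 0] c by simp
  qed
  then obtain L where L: "(\<lambda>k. F (U k)) \<longlonglongrightarrow> L" using incseq_convergent bdd by blast
  have gap: "(\<lambda>k. F (U (Suc k)) - F (U k)) \<longlonglongrightarrow> 0"
    using tendsto_diff[OF LIMSEQ_Suc[OF L] L] by simp
  have "(\<lambda>k. c * (norm (U (Suc k) $ i - U k $ i))\<^sup>2) \<longlonglongrightarrow> 0"
  proof (rule Lim_null_comparison[OF always_eventually gap], rule allI)
    fix k
    show "norm (c * (norm (U (Suc k) $ i - U k $ i))\<^sup>2) \<le> F (U (Suc k)) - F (U k)"
      using le[of k] c by (simp add: abs_mult)
  qed
  then have "(\<lambda>k. (norm (U (Suc k) $ i - U k $ i))\<^sup>2) \<longlonglongrightarrow> 0"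
    using c by (simp add: tendsto_mult_left_iff)
  from tendsto_real_sqrt[OF this] have "(\<lambda>k. norm (U (Suc k) $ i - U k $ i)) \<longlonglongrightarrow> 0" by simp
  then show ?thesis by (rule tendsto_norm_zero_cancel)
qed

section \<open>Passing to the limit\<close>

text \<open>
  Only finitely many pairs have a first component below a given bound, because the type of the
  second component is finite, and an increasing sequence takes each of them at most once.
\<close>

lemma lex_increasing_fst_at_top:
  fixes p :: "nat \<Rightarrow> nat \<times> 'd::{finite,linorder}"
  assumes "\<And>m. (p m, p (Suc m)) \<in> less_than <*lex*> {(i, j). i < j}"
  shows "filterlim (\<lambda>m. fst (p m)) at_top sequentially"
proof -
  let ?r = "less_than <*lex*> {(i :: 'd, j). i < j}"
  have tr: "trans ?r" by (intro trans_lex_prod) (auto simp: trans_def)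
  have less: "(p m, p (m + Suc n)) \<in> ?r" for m n
  proof (induction n)
    case (Suc n)
    then show ?case using transD[OF tr Suc.IH, of "p (m + Suc (Suc n))"] assms[of "m + Suc n"] by simp
  qed (use assms in simp)
  have "inj p"
  proof (rule linorder_injI)
    fix m n :: nat assume "m < n"
    then obtain k where "n = m + Suc k" by (auto simp: less_iff_Suc_add)
    with less[of m k] show "p m \<noteq> p n" by (cases "p n") (auto simp del: add_Suc_right)
  qed
  show ?thesis
    unfolding filterlim_at_top
  proof
    fix K
    have "finite (p -` ({..K} \<times> UNIV))" by (rule finite_vimageI[OF _ \<open>inj p\<close>]) simp
    then have "eventually (\<lambda>m. m \<notin> p -` ({..K} \<times> UNIV)) cofinite" by (simp add: eventually_cofinite vimage_def)
    then show "eventually (\<lambda>m. K \<le> fst (p m)) sequentially"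
      unfolding cofinite_eq_sequentially by eventually_elim (auto simp: mem_Times_iff)
  qed
qed

text \<open>
  These equations no longer mention \<open>P\<close>, which is \<open>U\<^sup>H X\<close>. They survive limits of \<open>X\<close> and
  \<open>U\<close> without any argument about the convergence of \<open>P\<close>.
\<close>

lemma polar_factor_recovered:
  assumes "polar_factor N R X U"
  shows "U ** (ctranspose U ** X) = X" "ctranspose (ctranspose U ** X) = ctranspose U ** X"
proof -
  obtain P where U: "U \<in> stiefel N R" and P: "P \<in> block_space R R" "hermitian_psd P"
    and X: "X = U ** P" using assms by (auto simp: polar_factor_def)
  have "ctranspose U ** X = P"
    using U P by (simp add: X matrix_mul_assoc stiefel_def mult_id_on)
  then show "U ** (ctranspose U ** X) = X" "ctranspose (ctranspose U ** X) = ctranspose U ** X"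
    using P by (simp_all add: X hermitian_psd_def)
qed

lemma riemannian_grad_eq_0:
  assumes "GDERIV h V :> G" "V ** (ctranspose V ** G) = G"
    "ctranspose (ctranspose V ** G) = ctranspose V ** G"
  shows "riemannian_grad h V = 0"
proof -
  have "msym (ctranspose V ** G) = ctranspose V ** G"
    unfolding msym_def assms(3) by (simp flip: scaleR_2)
  then show ?thesis by (simp add: riemannian_grad_def gradient_eq[OF assms(1)] assms(2))
qed

theorem theorem3p5:
  fixes N :: "'d::{finite,linorder} \<Rightarrow> 'n::finite set"
    and R :: "'d \<Rightarrow> 'r::finite set"
    and f :: "(complex^'r^'n, 'd) vec \<Rightarrow> real"
    and U :: "nat \<Rightarrow> (complex^'r^'n, 'd) vec"
    and \<delta> :: real
    and \<omega> :: "(complex^'r^'n, 'd) vec"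
  assumes "CARD('d) > 1"
    and "\<And>i. 1 \<le> card (R i) \<and> card (R i) \<le> card (N i)"
    and "\<And>x. x \<in> stiefel_prod N R \<Longrightarrow> 0 \<le> f x"
    and "smooth_objective N R f"
    and "block_multiconvex N R f"
    and "apdoi N R f U"
    and "\<delta> > 0"
    and "\<And>k i. k \<ge> 1 \<Longrightarrow>
           sigma_min (R i) (gradient (sub_objective N R f U k i) (U (k - 1) $ i)) > \<delta>"
    and "accumulation_point (iterate U) \<omega>"
  shows "stationary_point N R f \<omega>"
proof -
  obtain W where W: "open W" "stiefel_prod N R \<subseteq> W" "smooth_on f W"
    using assms(4) by (auto simp: smooth_objective_def)
  have R: "R i \<noteq> {}" for i using assms(2)[of i] by auto
  let ?G = "block_gradient N R f" and ?S = "partial_sweep U"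
  have U: "U k \<in> stiefel_prod N R" for k
    using assms(6) by (cases k) (auto simp: apdoi_def polar_factor_def stiefel_prod_def)
  have S: "?S k A \<in> stiefel_prod N R" for k A
    by (rule partial_sweep_stiefel[OF U])
  have grad: "gradient (sub_objective N R f U k i) (U (k - 1) $ i) = ?G i (?S k {..<i})" for k i
    using gradient_eq[OF GDERIV_restr_smooth[OF S W, of k "{..<i}" i]]
    by (simp add: sub_objective_partial_sweep) (simp add: partial_sweep_def)
  have pf: "polar_factor (N i) (R i) (?G i (?S (Suc k) {..<i})) (U (Suc k) $ i)" for k i
    using assms(6) by (simp only: apdoi_def grad)
  have step: "f (?S (Suc k) {..<i}) + \<delta> / 2 * (norm (U (Suc k) $ i - U k $ i))\<^sup>2
      \<le> f (?S (Suc k) {..i})" for k i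
  proof -
    let ?x = "?S (Suc k) {..<i}"
    have "(\<chi> j. if j = i then U (Suc k) $ i else ?x $ j) = ?S (Suc k) {..i}"
      by (auto simp: partial_sweep_def vec_eq_iff)
    then have "f ?x + sigma_min (R i) (?G i ?x) / 2 * (norm (U (Suc k) $ i - ?x $ i))\<^sup>2 \<le> f (?S (Suc k) {..i})"
      using block_step_gain[OF S W assms(5) R pf, of k i] by simp
    moreover have "?x $ i = U k $ i" by (simp add: partial_sweep_def)
    moreover have "\<delta> / 2 * (norm (U (Suc k) $ i - U k $ i))\<^sup>2
        \<le> sigma_min (R i) (?G i ?x) / 2 * (norm (U (Suc k) $ i - U k $ i))\<^sup>2"
      using assms(8)[of "Suc k" i] by (intro mult_right_mono) (simp_all add: grad[of "Suc k", simplified])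
    ultimately show ?thesis by simp
  qed
  have gain: "f (U k) + \<delta> / 2 * (\<Sum>i\<in>UNIV. (norm (U (Suc k) $ i - U k $ i))\<^sup>2) \<le> f (U (Suc k))" for k
    using sum_gains_along_order[of "\<lambda>A. f (?S (Suc k) A)", OF step[of k]]
    by (simp add: partial_sweep_def sum_distrib_left)
  have "continuous_on W f"
    using W(3) by (metis smooth_on_def ck_on.simps(1))
  then have "compact (f ` stiefel_prod N R)"
    using W(2) by (intro compact_continuous_image compact_stiefel_prod) (rule continuous_on_subset)
  then obtain B where B: "\<And>k. f (U k) \<le> B"
    using U bounded_imp_bdd_above[OF compact_imp_bounded] by (meson bdd_above.E image_eqI)
  then have vanish: "(\<lambda>k. U (Suc k) $ i - U k $ i) \<longlonglongrightarrow> 0" for i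
    using assms(7) by (intro steps_vanish[of f U "\<delta> / 2" B, OF gain _ B]) simp

  obtain p where p1: "\<And>m. fst (p m) \<ge> 1"
    and plex: "\<And>m. (p m, p (Suc m)) \<in> less_than <*lex*> {(i, j). i < j}"
    and plim: "(\<lambda>m. iterate U (fst (p m)) (snd (p m))) \<longlonglongrightarrow> \<omega>"
    using assms(9) by (auto simp: accumulation_point_def)
  (* sweep number shifted by one, as sweep k + 1 starts from U k *)
  define q where "q m = fst (p m) - 1" for m
  have q: "fst (p m) = Suc (q m)" for m using p1[of m] by (simp add: q_def)
  have "filterlim (\<lambda>m. Suc (q m)) sequentially sequentially"
    using lex_increasing_fst_at_top[of p, OF plex] by (simp add: q)
  then have qlim: "filterlim q sequentially sequentially"
    unfolding filterlim_at_top by (metis (mono_tags, lifting) Suc_le_mono eventually_mono)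
  (* all tuples of one sweep differ blockwise by at most one step, so they share the limit *)
  have Slim: "(\<lambda>m. ?S (Suc (q m)) A) \<longlonglongrightarrow> \<omega>" for A
  proof (rule vec_tendstoI)
    fix j
    let ?w = "\<lambda>m. iterate U (fst (p m)) (snd (p m))"
    have "(\<lambda>m. norm (U (Suc (q m)) $ j - U (q m) $ j)) \<longlonglongrightarrow> 0"
      using tendsto_norm_zero[OF filterlim_compose[OF vanish qlim]] .
    then have "(\<lambda>m. ?S (Suc (q m)) A $ j - ?w m $ j) \<longlonglongrightarrow> 0"
      by (rule Lim_null_comparison[rotated])
         (auto simp: iterate_partial_sweep q partial_sweep_def norm_minus_commute)
    from tendsto_add[OF this tendsto_vec_nth[OF plim, of j]]
    show "(\<lambda>m. ?S (Suc (q m)) A $ j) \<longlonglongrightarrow> \<omega> $ j" by simp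
  qed
  have \<omega>: "\<omega> \<in> stiefel_prod N R"
    using closed_sequentially[OF compact_imp_closed[OF compact_stiefel_prod] _ Slim] S by blast
  have "riemannian_grad (restr N R f \<omega> i) (\<omega> $ i) = 0" for i
  proof (rule riemannian_grad_eq_0[OF GDERIV_restr_smooth[OF \<omega> W]])
    let ?X = "\<lambda>m. ?G i (?S (Suc (q m)) {..<i})" and ?V = "\<lambda>m. U (Suc (q m)) $ i"
    have X: "?X \<longlonglongrightarrow> ?G i \<omega>"
      using \<omega> S W(2)
      by (intro continuous_on_tendsto_compose[OF continuous_on_block_gradient[OF W(3)] Slim]
          always_eventually) auto
    have "(\<lambda>m. ?S (Suc (q m)) UNIV $ i) \<longlonglongrightarrow> \<omega> $ i" by (intro tendsto_intros Slim)
    then have V: "?V \<longlonglongrightarrow> \<omega> $ i" by (simp add: partial_sweep_def)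
    have H: "(\<lambda>m. ctranspose (?V m) ** ?X m) \<longlonglongrightarrow> ctranspose (\<omega> $ i) ** ?G i \<omega>"
      by (intro tendsto_intros X V)
    show "\<omega> $ i ** (ctranspose (\<omega> $ i) ** ?G i \<omega>) = ?G i \<omega>"
      using LIMSEQ_unique[OF tendsto_matrix_mult[OF V H]] X by (simp add: polar_factor_recovered(1)[OF pf])
    show "ctranspose (ctranspose (\<omega> $ i) ** ?G i \<omega>) = ctranspose (\<omega> $ i) ** ?G i \<omega>"
      using LIMSEQ_unique[OF tendsto_ctranspose[OF H]] H by (simp add: polar_factor_recovered(2)[OF pf])
  qed
  with \<omega> show ?thesis
    by (simp add: stationary_point_def riemannian_grad_prod_def vec_eq_iff)
qed

end
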